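(* There exists a geodesically incomplete compact $3$-dimensional Lorentzian manifold with a periodic null Killing field.
   Context: A null Killing field is a Killing vector field $V$ that is nowhere zero and satisfies $g(V,V)=0$ everywhere; it is periodic if its flow factors through an action of the circle $\mathbb{S}^1$. A Lorentzian manifold is incomplete if some geodesic cannot be extended to an affinely parametrized geodesic defined on all of $\mathbb{R}$. *)

theory Defs
  imports "HOL-Analysis.Analysis"
begin

section \<open>Smooth manifolds\<close>

text \<open>\<open>C\<^sup>k\<close> regularity on an open set: all iterated directional derivatives up to order \<open>k\<close>
  exist and are continuous, and those of order below \<open>k\<close> are Frechet differentiable.\<close>

fun Ck_on :: "nat \<Rightarrow> 'a::euclidean_space set \<Rightarrow> ('a \<Rightarrow> 'b::real_normed_vector) \<Rightarrow> bool" where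
  "Ck_on 0 S f \<longleftrightarrow> continuous_on S f"
| "Ck_on (Suc k) S f \<longleftrightarrow> (\<forall>x\<in>S. f differentiable (at x)) \<and>
     (\<forall>v. Ck_on k S (\<lambda>x. frechet_derivative f (at x) v))"

definition smooth_on :: "'a::euclidean_space set \<Rightarrow> ('a \<Rightarrow> 'b::real_normed_vector) \<Rightarrow> bool" where
  "smooth_on S f \<longleftrightarrow> (\<forall>k. Ck_on k S f)"

text \<open>A chart is a pair of its domain and its coordinate map; the values of the coordinate map
  outside the domain are irrelevant.\<close>

type_synonym ('p, 'n) chart = "'p set \<times> ('p \<Rightarrow> real ^ 'n)"

definition chart_image :: "('p, 'n::finite) chart \<Rightarrow> (real ^ 'n) set" where
  "chart_image c = snd c ` fst c"

definition overlap :: "('p, 'n::finite) chart \<Rightarrow> ('p, 'n) chart \<Rightarrow> (real ^ 'n) set" where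
  "overlap c d = snd c ` (fst c \<inter> fst d)"

definition transition :: "('p, 'n::finite) chart \<Rightarrow> ('p, 'n) chart \<Rightarrow> real ^ 'n \<Rightarrow> real ^ 'n" where
  "transition c d = snd d \<circ> inv_into (fst c) (snd c)"

definition chart_on :: "'p topology \<Rightarrow> ('p, 'n::finite) chart \<Rightarrow> bool" where
  "chart_on X c \<longleftrightarrow> openin X (fst c) \<and> open (chart_image c) \<and>
     homeomorphic_map (subtopology X (fst c)) (top_of_set (chart_image c)) (snd c)"

definition second_countable_space :: "'p topology \<Rightarrow> bool" where
  "second_countable_space X \<longleftrightarrow>
     (\<exists>B. countable B \<and> openin X = arbitrary union_of (\<lambda>W. W \<in> B))"

text \<open>A smooth structure is given by a (not necessarily maximal) smooth atlas. Smoothness,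
  tensor fields, geodesics etc. below do not change when the atlas is enlarged by compatible
  charts. The dimension is \<open>CARD('n)\<close>, and manifolds have no boundary.\<close>

definition smooth_manifold :: "'p topology \<Rightarrow> ('p, 'n::finite) chart set \<Rightarrow> bool" where
  "smooth_manifold X A \<longleftrightarrow>
     Hausdorff_space X \<and> second_countable_space X \<and>
     (\<forall>c\<in>A. chart_on X c) \<and> (\<Union>c\<in>A. fst c) = topspace X \<and>
     (\<forall>c\<in>A. \<forall>d\<in>A. smooth_on (overlap c d) (transition c d))"

section \<open>Vector fields and Lorentzian metrics\<close>

text \<open>Tensor fields are given by their components in each chart, as functions of the coordinates,
  subject to the tensorial transformation law under changes of charts.\<close>

type_synonym ('p, 'n) vector_field = "('p, 'n) chart \<Rightarrow> real ^ 'n \<Rightarrow> real ^ 'n"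
type_synonym ('p, 'n) bilinear_field = "('p, 'n) chart \<Rightarrow> real ^ 'n \<Rightarrow> real ^ 'n ^ 'n"

definition smooth_vector_field ::
  "('p, 'n::finite) chart set \<Rightarrow> ('p, 'n) vector_field \<Rightarrow> bool" where
  "smooth_vector_field A V \<longleftrightarrow>
     (\<forall>c\<in>A. smooth_on (chart_image c) (V c)) \<and>
     (\<forall>c\<in>A. \<forall>d\<in>A. \<forall>x\<in>overlap c d.
        V d (transition c d x) = jacobian (transition c d) (at x) *v V c x)"

definition smooth_bilinear_field ::
  "('p, 'n::finite) chart set \<Rightarrow> ('p, 'n) bilinear_field \<Rightarrow> bool" where
  "smooth_bilinear_field A g \<longleftrightarrow>
     (\<forall>c\<in>A. smooth_on (chart_image c) (g c)) \<and>
     (\<forall>c\<in>A. \<forall>d\<in>A. \<forall>x\<in>overlap c d.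
        g c x = transpose (jacobian (transition c d) (at x)) **
          g d (transition c d x) ** jacobian (transition c d) (at x))"

text \<open>Gram matrices of signature \<open>(-,+,\<dots>,+)\<close>: some basis (the columns of \<open>P\<close>) is orthogonal with
  one vector of square \<open>-1\<close> and all others of square \<open>1\<close>. In particular \<open>G\<close> is symmetric and
  nondegenerate.\<close>

definition lorentzian_matrix :: "real ^ 'n ^ 'n::finite \<Rightarrow> bool" where
  "lorentzian_matrix G \<longleftrightarrow>
     (\<exists>(P :: real ^ 'n ^ 'n) k. invertible P \<and>
        transpose P ** G ** P = (\<chi> i j. if i \<noteq> j then 0 else if i = k then - 1 else 1))"

definition lorentzian_metric ::
  "('p, 'n::finite) chart set \<Rightarrow> ('p, 'n) bilinear_field \<Rightarrow> bool" where
  "lorentzian_metric A g \<longleftrightarrow> smooth_bilinear_field A g \<and>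
     (\<forall>c\<in>A. \<forall>x\<in>chart_image c. lorentzian_matrix (g c x))"

definition lorentzian_manifold ::
  "'p topology \<Rightarrow> ('p, 'n::finite) chart set \<Rightarrow> ('p, 'n) bilinear_field \<Rightarrow> bool" where
  "lorentzian_manifold X A g \<longleftrightarrow> smooth_manifold X A \<and> connected_space X \<and> lorentzian_metric A g"

section \<open>Geodesics\<close>

definition partial_deriv ::
  "'n::finite \<Rightarrow> (real ^ 'n \<Rightarrow> 'b::real_normed_vector) \<Rightarrow> real ^ 'n \<Rightarrow> 'b" where
  "partial_deriv i f x = frechet_derivative f (at x) (axis i 1)"

text \<open>The Christoffel symbol \<open>\<Gamma>\<^sup>k\<^sub>i\<^sub>j\<close> of the Levi-Civita connection of a metric \<open>G\<close> given in
  coordinates.\<close>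

definition christoffel ::
  "(real ^ 'n \<Rightarrow> real ^ 'n ^ 'n::finite) \<Rightarrow> 'n \<Rightarrow> 'n \<Rightarrow> 'n \<Rightarrow> real ^ 'n \<Rightarrow> real" where
  "christoffel G k i j x =
     (\<Sum>l\<in>UNIV. matrix_inv (G x) $ k $ l *
        (partial_deriv i G x $ j $ l + partial_deriv j G x $ i $ l - partial_deriv l G x $ i $ j))
     / 2"

text \<open>Affinely parametrized geodesics defined on an open interval \<open>I\<close>; here \<open>u\<close> and \<open>a\<close> are the
  first and second derivatives of \<open>\<gamma>\<close> in the chart \<open>c\<close>. Values of \<open>\<gamma>\<close> outside \<open>I\<close> are
  irrelevant.\<close>

definition geodesic_on ::
  "'p topology \<Rightarrow> ('p, 'n::finite) chart set \<Rightarrow> ('p, 'n) bilinear_field \<Rightarrow>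
    real set \<Rightarrow> (real \<Rightarrow> 'p) \<Rightarrow> bool" where
  "geodesic_on X A g I \<gamma> \<longleftrightarrow>
     open I \<and> is_interval I \<and> I \<noteq> {} \<and> continuous_map (top_of_set I) X \<gamma> \<and>
     (\<forall>c\<in>A. \<exists>u a. \<forall>t\<in>I. \<gamma> t \<in> fst c \<longrightarrow>
        ((snd c \<circ> \<gamma>) has_vector_derivative u t) (at t) \<and>
        (u has_vector_derivative a t) (at t) \<and>
        (\<forall>k. a t $ k +
           (\<Sum>i\<in>UNIV. \<Sum>j\<in>UNIV. christoffel (g c) k i j (snd c (\<gamma> t)) * u t $ i * u t $ j) = 0))"

definition geodesically_incomplete ::
  "'p topology \<Rightarrow> ('p, 'n::finite) chart set \<Rightarrow> ('p, 'n) bilinear_field \<Rightarrow> bool" where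
  "geodesically_incomplete X A g \<longleftrightarrow>
     (\<exists>I \<gamma>. geodesic_on X A g I \<gamma> \<and>
        \<not> (\<exists>\<delta>. geodesic_on X A g UNIV \<delta> \<and> (\<forall>t\<in>I. \<delta> t = \<gamma> t)))"

section \<open>Periodic null Killing fields\<close>

text \<open>Killing equation \<open>L\<^sub>V g = 0\<close>, with the Lie derivative written out in coordinates.\<close>

definition killing_field ::
  "('p, 'n::finite) chart set \<Rightarrow> ('p, 'n) bilinear_field \<Rightarrow> ('p, 'n) vector_field \<Rightarrow> bool" where
  "killing_field A g V \<longleftrightarrow> smooth_vector_field A V \<and>
     (\<forall>c\<in>A. \<forall>x\<in>chart_image c. \<forall>i j.
        (\<Sum>k\<in>UNIV. V c x $ k * partial_deriv k (g c) x $ i $ j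
           + g c x $ k $ j * partial_deriv i (V c) x $ k
           + g c x $ i $ k * partial_deriv j (V c) x $ k) = 0)"

definition null_killing_field ::
  "('p, 'n::finite) chart set \<Rightarrow> ('p, 'n) bilinear_field \<Rightarrow> ('p, 'n) vector_field \<Rightarrow> bool" where
  "null_killing_field A g V \<longleftrightarrow> killing_field A g V \<and>
     (\<forall>c\<in>A. \<forall>x\<in>chart_image c. V c x \<noteq> 0 \<and> V c x \<bullet> (g c x *v V c x) = 0)"

definition integral_curve ::
  "'p topology \<Rightarrow> ('p, 'n::finite) chart set \<Rightarrow> ('p, 'n) vector_field \<Rightarrow> (real \<Rightarrow> 'p) \<Rightarrow> bool" where
  "integral_curve X A V \<gamma> \<longleftrightarrow> continuous_map euclideanreal X \<gamma> \<and>
     (\<forall>c\<in>A. \<forall>t. \<gamma> t \<in> fst c \<longrightarrow>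
        ((snd c \<circ> \<gamma>) has_vector_derivative V c (snd c (\<gamma> t))) (at t))"

definition flow_of ::
  "'p topology \<Rightarrow> ('p, 'n::finite) chart set \<Rightarrow> ('p, 'n) vector_field \<Rightarrow>
    (real \<Rightarrow> 'p \<Rightarrow> 'p) \<Rightarrow> bool" where
  "flow_of X A V \<Phi> \<longleftrightarrow>
     (\<forall>p\<in>topspace X. \<Phi> 0 p = p \<and> integral_curve X A V (\<lambda>t. \<Phi> t p))"

definition circle_action :: "'p topology \<Rightarrow> (complex \<Rightarrow> 'p \<Rightarrow> 'p) \<Rightarrow> bool" where
  "circle_action X \<alpha> \<longleftrightarrow>
     continuous_map (prod_topology (top_of_set (sphere 0 1)) X) X (\<lambda>(z, p). \<alpha> z p) \<and>
     (\<forall>p\<in>topspace X. \<alpha> 1 p = p) \<and>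
     (\<forall>z\<in>sphere 0 1. \<forall>w\<in>sphere 0 1. \<forall>p\<in>topspace X. \<alpha> (z * w) p = \<alpha> z (\<alpha> w p))"

text \<open>The flow factors through the covering homomorphism \<open>t \<mapsto> exp (2 \<pi> i t / T)\<close> from the line
  onto the circle. The circle action is then automatically smooth, since the flow is.\<close>

definition periodic_field ::
  "'p topology \<Rightarrow> ('p, 'n::finite) chart set \<Rightarrow> ('p, 'n) vector_field \<Rightarrow> bool" where
  "periodic_field X A V \<longleftrightarrow>
     (\<exists>\<Phi> \<alpha> T. flow_of X A V \<Phi> \<and> circle_action X \<alpha> \<and> T > 0 \<and>
        (\<forall>t. \<forall>p\<in>topspace X. \<Phi> t p = \<alpha> (cis (2 * pi * t / T)) p))"

end

theory Submission
  imports Defs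
begin

text \<open>
  The example is the three-dimensional torus with angle coordinates \<open>x, y, z\<close> and the metric
  \<open>g = dx\<^sup>2 + dy\<^sup>2 + 2 \<omega> dz\<close>, where \<open>\<omega> = cos x dx + sin x dy\<close>. It is Lorentzian because \<open>\<omega>\<close> vanishes
  nowhere and \<open>dx\<^sup>2 + dy\<^sup>2\<close> is positive on its kernel in the \<open>xy\<close>-plane. The field \<open>\<partial>\<^sub>z\<close> is null; it is
  Killing since the coefficients of \<open>g\<close> do not depend on \<open>z\<close>; and its flow rotates the last circle.

  Incompleteness comes from the circle \<open>x = 0\<close>, a closed leaf of the foliation of the \<open>xy\<close>-torus by
  the kernel of \<open>\<omega>\<close>. Its holonomy is not isometric: nearby leaves satisfy \<open>dx/dy = - tan x\<close>
  and approach it as \<open>y\<close> increases. For a geodesic that is not orthogonal to \<open>\<partial>\<^sub>z\<close>, this makes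
  the acceleration along the leaf quadratic in the velocity along the leaf, as in \<open>s'' = s'\<^sup>2 / 2\<close>, whose
  nonconstant solutions blow up in finite time. The symmetry in \<open>y\<close> makes one such geodesic explicit: the
  conserved quantities \<open>g(\<partial>\<^sub>z, u)\<close>, \<open>g(\<partial>\<^sub>y, u)\<close> and \<open>g(u, u)\<close> determine its velocity \<open>u\<close> as a function of
  \<open>x\<close>, with poles at \<open>x = 0\<close>, while \<open>x' = cos x\<close> puts it there a finite time in the past. It is
  \<open>escaping_angles\<close>, defined for \<open>t > 0\<close>; \<open>escaping_geodesic_equation\<close> shows that it is a geodesic
  and \<open>geodesically_incomplete_torus\<close> that it has no extension through \<open>t = 0\<close>.

  The angle charts are local inverses of the covering map \<open>torus_point\<close>, so that changes of charts
  are locally translations (\<open>chart_torus_point_locally_translation\<close>). Therefore periodic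
  functions of the angles are the components of tensor fields in all charts at once, and computations
  can be made on lifts to the space of angles.
\<close>

section \<open>The torus and its angle charts\<close>

definition torus :: "(complex ^ 'n) set" where
  "torus = {p. \<forall>i. cmod (p $ i) = 1}"

definition torus_point :: "real ^ 'n \<Rightarrow> complex ^ 'n" where
  "torus_point x = (\<chi> i. cis (x $ i))"

definition angle_box :: "real ^ 'n \<Rightarrow> (real ^ 'n) set" where
  "angle_box \<theta> = {x. \<forall>i. \<bar>x $ i - \<theta> $ i\<bar> < pi}"

text \<open>Angles are measured relative to the centre \<open>\<theta>\<close>, so that the branch cut of the argument lies
  opposite to the centre. As \<open>\<theta>\<close> varies, these domains cover the torus, and every point
  is the centre of some chart.\<close>

definition angle_chart :: "real ^ 'n::finite \<Rightarrow> (complex ^ 'n, 'n) chart" where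
  "angle_chart \<theta> =
     ({p \<in> torus. \<forall>i. p $ i * cis (- \<theta> $ i) \<notin> \<real>\<^sub>\<le>\<^sub>0},
      \<lambda>p. \<chi> i. \<theta> $ i + Arg (p $ i * cis (- \<theta> $ i)))"

abbreviation torus_topology :: "(complex ^ 'n::finite) topology" where
  "torus_topology \<equiv> top_of_set torus"

abbreviation torus_atlas :: "(complex ^ 'n::finite, 'n) chart set" where
  "torus_atlas \<equiv> range angle_chart"

lemma torus_point_in_torus: "torus_point x \<in> torus"
  by (simp add: torus_def torus_point_def)

lemma fst_chart_subset: "fst (angle_chart \<theta>) \<subseteq> torus"
  by (auto simp: angle_chart_def)

lemma center_in_box: "\<theta> \<in> angle_box \<theta>"
  by (simp add: angle_box_def)

lemma open_angle_box: "open (angle_box (\<theta> :: real ^ 'n::finite))"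
proof -
  have "angle_box \<theta> = (\<Inter>i\<in>UNIV. {x. \<bar>x $ i - \<theta> $ i\<bar> < pi})"
    by (auto simp: angle_box_def)
  moreover have "open {x :: real ^ 'n. \<bar>x $ i - \<theta> $ i\<bar> < pi}" for i
    by (intro open_Collect_less continuous_intros)
  ultimately show ?thesis by auto
qed

lemma continuous_torus_point: "continuous_on S torus_point"
  unfolding torus_point_def by (intro continuous_intros)

lemma torus_point_in_chart:
  assumes "x \<in> angle_box \<theta>"
  shows "torus_point x \<in> fst (angle_chart \<theta>)"
proof -
  have "cis (x $ i) * cis (- \<theta> $ i) \<notin> \<real>\<^sub>\<le>\<^sub>0" for i
  proof
    assume "cis (x $ i) * cis (- \<theta> $ i) \<in> \<real>\<^sub>\<le>\<^sub>0"
    then have *: "cos (x $ i - \<theta> $ i) \<le> 0" "sin (x $ i - \<theta> $ i) = 0"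
      by (auto simp: cis_mult complex_nonpos_Reals_iff)
    moreover have "\<bar>x $ i - \<theta> $ i\<bar> < pi"
      using assms by (simp add: angle_box_def)
    ultimately have "x $ i - \<theta> $ i = 0"
      using sin_eq_0_pi[of "x $ i - \<theta> $ i"] by linarith
    with * show False by simp
  qed
  then show ?thesis
    using torus_point_in_torus by (auto simp: angle_chart_def torus_point_def)
qed

lemma chart_torus_point:
  assumes "x \<in> angle_box \<theta>"
  shows "snd (angle_chart \<theta>) (torus_point x) = x"
proof -
  have "Arg (cis (x $ i - \<theta> $ i)) = x $ i - \<theta> $ i" for i
  proof (rule Arg_cis)
    have "\<bar>x $ i - \<theta> $ i\<bar> < pi"
      using assms by (simp add: angle_box_def)
    then show "x $ i - \<theta> $ i \<in> {- pi<..pi}"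
      by auto
  qed
  then show ?thesis
    by (simp add: angle_chart_def torus_point_def cis_mult vec_eq_iff)
qed

lemma
  assumes "p \<in> fst (angle_chart \<theta>)"
  shows chart_in_box: "snd (angle_chart \<theta>) p \<in> angle_box \<theta>"
    and torus_point_chart: "torus_point (snd (angle_chart \<theta>) p) = p"
proof -
  have p: "cmod (p $ i) = 1" "p $ i * cis (- \<theta> $ i) \<notin> \<real>\<^sub>\<le>\<^sub>0" for i
    using assms by (auto simp: angle_chart_def torus_def)
  have nz: "p $ i * cis (- \<theta> $ i) \<noteq> 0" for i
    using p(1)[of i] by auto
  have "\<bar>Arg (p $ i * cis (- \<theta> $ i))\<bar> < pi" for i
  proof -
    have "Arg (p $ i * cis (- \<theta> $ i)) \<noteq> pi"
      using p(2)[of i] nz[of i] Arg_eq_pi[of "p $ i * cis (- \<theta> $ i)"]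
      by (auto simp: complex_nonpos_Reals_iff)
    then show ?thesis
      using mpi_less_Arg[of "p $ i * cis (- \<theta> $ i)"] Arg_le_pi[of "p $ i * cis (- \<theta> $ i)"]
      by (simp add: abs_less_iff)
  qed
  then show "snd (angle_chart \<theta>) p \<in> angle_box \<theta>"
    by (simp add: angle_chart_def angle_box_def)
  have "cis (\<theta> $ i + Arg (p $ i * cis (- \<theta> $ i))) = p $ i" for i
  proof -
    have "cis (\<theta> $ i + Arg (p $ i * cis (- \<theta> $ i)))
        = cis (\<theta> $ i) * cis (Arg (p $ i * cis (- \<theta> $ i)))"
      by (simp add: cis_mult)
    also have "cis (Arg (p $ i * cis (- \<theta> $ i))) = p $ i * cis (- \<theta> $ i)"
      using nz[of i] p(1)[of i] by (simp add: cis_Arg sgn_div_norm norm_mult)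
    finally show ?thesis
      by (simp add: cis_mult ac_simps)
  qed
  then show "torus_point (snd (angle_chart \<theta>) p) = p"
    by (simp add: angle_chart_def torus_point_def vec_eq_iff)
qed

lemma chart_image_angle_chart: "chart_image (angle_chart \<theta>) = angle_box \<theta>"
  unfolding chart_image_def
proof (intro equalityI subsetI)
  show "x \<in> angle_box \<theta>" if "x \<in> snd (angle_chart \<theta>) ` fst (angle_chart \<theta>)" for x
    using that by (elim imageE) (simp add: chart_in_box)
  show "x \<in> snd (angle_chart \<theta>) ` fst (angle_chart \<theta>)" if "x \<in> angle_box \<theta>" for x
  proof (rule image_eqI)
    show "x = snd (angle_chart \<theta>) (torus_point x)"
      by (rule chart_torus_point[OF that, symmetric])
    show "torus_point x \<in> fst (angle_chart \<theta>)"
      by (rule torus_point_in_chart[OF that])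
  qed
qed

lemma openin_chart_domain: "openin torus_topology (fst (angle_chart (\<theta> :: real ^ 'n::finite)))"
proof -
  have "open ((\<lambda>p :: complex ^ 'n. p $ i * cis (- \<theta> $ i)) -` (- \<real>\<^sub>\<le>\<^sub>0))" for i
  proof (rule open_vimage)
    show "open (- \<real>\<^sub>\<le>\<^sub>0 :: complex set)"
      using closed_nonpos_Reals_complex by blast
    show "continuous_on UNIV (\<lambda>p :: complex ^ 'n. p $ i * cis (- \<theta> $ i))"
      by (intro continuous_intros)
  qed
  then have "open (\<Inter>i\<in>UNIV. (\<lambda>p :: complex ^ 'n. p $ i * cis (- \<theta> $ i)) -` (- \<real>\<^sub>\<le>\<^sub>0))"
    by (intro open_INT) simp_all
  moreover have "fst (angle_chart \<theta>)
      = torus \<inter> (\<Inter>i\<in>UNIV. (\<lambda>p :: complex ^ 'n. p $ i * cis (- \<theta> $ i)) -` (- \<real>\<^sub>\<le>\<^sub>0))"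
    unfolding angle_chart_def fst_conv by blast
  ultimately show ?thesis
    unfolding openin_open by blast
qed

lemma continuous_on_chart: "continuous_on (fst (angle_chart \<theta>)) (snd (angle_chart \<theta>))"
  unfolding angle_chart_def fst_conv snd_conv by (intro continuous_intros) auto

lemma chart_on_angle_chart: "chart_on torus_topology (angle_chart \<theta>)"
proof -
  let ?c = "angle_chart \<theta>"
  have "homeomorphic_maps (top_of_set (fst ?c)) (top_of_set (angle_box \<theta>)) (snd ?c) torus_point"
    unfolding homeomorphic_maps_def
    using continuous_on_chart continuous_torus_point chart_in_box torus_point_in_chart
      chart_torus_point torus_point_chart
    by (auto simp: continuous_map_in_subtopology)
  moreover have "subtopology torus_topology (fst ?c) = top_of_set (fst ?c)"
    using fst_chart_subset[of \<theta>] by (simp add: subtopology_subtopology Int_absorb1)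
  ultimately show ?thesis
    unfolding chart_on_def chart_image_angle_chart
    using openin_chart_domain open_angle_box by (auto simp: homeomorphic_map_maps)
qed

lemma torus_point_Arg:
  assumes "p \<in> torus"
  shows "torus_point (\<chi> i. Arg (p $ i)) = p"
proof -
  have "cis (Arg (p $ i)) = p $ i" for i
  proof -
    have "cmod (p $ i) = 1"
      using assms by (simp add: torus_def)
    moreover from this have "p $ i \<noteq> 0"
      by auto
    ultimately show ?thesis
      by (simp add: cis_Arg sgn_div_norm)
  qed
  then show ?thesis
    by (simp add: torus_point_def vec_eq_iff)
qed

lemma torus_charted:
  assumes "p \<in> torus"
  obtains \<theta> where "p \<in> fst (angle_chart \<theta>)"
proof
  show "p \<in> fst (angle_chart (\<chi> i. Arg (p $ i)))"
    using torus_point_in_chart[OF center_in_box] torus_point_Arg[OF assms] by metis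
qed

lemma torus_eq_range: "torus = range torus_point"
proof (intro equalityI subsetI)
  show "p \<in> range torus_point" if "p \<in> torus" for p :: "complex ^ 'n"
    using torus_point_Arg[OF that, symmetric] by (rule range_eqI)
qed (auto simp: torus_point_in_torus)

text \<open>An angle chart is a local inverse of the covering map from the space of angles to the
  torus, and two local inverses of it differ by a deck transformation, which is a translation.
  This one fact makes transition maps have derivative the identity, and it lets curves on the
  torus be differentiated through their lifts.\<close>

lemma chart_torus_point_locally_translation:
  assumes "torus_point x \<in> fst (angle_chart \<theta>)"
  obtains d where "eventually (\<lambda>y. snd (angle_chart \<theta>) (torus_point y) = y + d) (nhds x)"
proof
  define d where "d = snd (angle_chart \<theta>) (torus_point x) - x"
  have "torus_point (x + d) = torus_point x"
    using torus_point_chart[OF assms] by (simp add: d_def)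
  then have "cis (x $ i) * cis (d $ i) = cis (x $ i)" for i
    by (simp add: torus_point_def vec_eq_iff cis_mult)
  then have "cis (d $ i) = 1" for i
    by (metis cis_neq_zero mult_cancel_left2 mult.commute)
  then have per: "torus_point (y + d) = torus_point y" for y
    by (simp add: torus_point_def vec_eq_iff flip: cis_mult)
  have "x + d \<in> angle_box \<theta>"
    using chart_in_box[OF assms] by (simp add: d_def)
  moreover have "((\<lambda>y. y + d) \<longlongrightarrow> x + d) (nhds x)"
    by (intro tendsto_intros filterlim_ident)
  ultimately have "eventually (\<lambda>y. y + d \<in> angle_box \<theta>) (nhds x)"
    using open_angle_box topological_tendstoD by blast
  then show "eventually (\<lambda>y. snd (angle_chart \<theta>) (torus_point y) = y + d) (nhds x)"
    by eventually_elim (metis chart_torus_point per)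
qed

lemma transition_angle_chart:
  assumes "x \<in> overlap (angle_chart \<theta>) (angle_chart \<eta>)"
  shows "transition (angle_chart \<theta>) (angle_chart \<eta>) x = snd (angle_chart \<eta>) (torus_point x)"
    and "torus_point x \<in> fst (angle_chart \<eta>)"
proof -
  obtain p where p: "p \<in> fst (angle_chart \<theta>)" "p \<in> fst (angle_chart \<eta>)"
    "x = snd (angle_chart \<theta>) p"
    using assms by (auto simp: overlap_def)
  then have "torus_point x = p"
    by (simp add: torus_point_chart)
  moreover have "inv_into (fst (angle_chart \<theta>)) (snd (angle_chart \<theta>)) x = p"
    unfolding p(3) by (rule inv_into_f_f[OF inj_on_inverseI p(1)]) (rule torus_point_chart)
  ultimately show "transition (angle_chart \<theta>) (angle_chart \<eta>) x
      = snd (angle_chart \<eta>) (torus_point x)"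
    "torus_point x \<in> fst (angle_chart \<eta>)"
    using p by (auto simp: transition_def)
qed

lemma overlap_eq:
  "overlap (angle_chart \<theta>) (angle_chart \<eta>)
     = {x \<in> angle_box \<theta>. torus_point x \<in> fst (angle_chart \<eta>)}"
proof (intro equalityI subsetI)
  show "x \<in> {x \<in> angle_box \<theta>. torus_point x \<in> fst (angle_chart \<eta>)}"
    if "x \<in> overlap (angle_chart \<theta>) (angle_chart \<eta>)" for x
    using that transition_angle_chart(2)[OF that]
    by (auto simp: overlap_def elim!: imageE intro: chart_in_box)
  show "x \<in> overlap (angle_chart \<theta>) (angle_chart \<eta>)"
    if "x \<in> {x \<in> angle_box \<theta>. torus_point x \<in> fst (angle_chart \<eta>)}" for x
    unfolding overlap_def
  proof (rule image_eqI)
    show "x = snd (angle_chart \<theta>) (torus_point x)"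
      using that chart_torus_point[of x \<theta>] by simp
    show "torus_point x \<in> fst (angle_chart \<theta>) \<inter> fst (angle_chart \<eta>)"
      using that torus_point_in_chart[of x \<theta>] by simp
  qed
qed

lemma open_overlap: "open (overlap (angle_chart \<theta>) (angle_chart (\<eta> :: real ^ 'n::finite)))"
proof -
  obtain W where W: "open W" "fst (angle_chart \<eta>) = torus \<inter> W"
    using openin_chart_domain[of \<eta>] by (auto simp: openin_open)
  have "overlap (angle_chart \<theta>) (angle_chart \<eta>) = angle_box \<theta> \<inter> torus_point -` W"
    using W(2) torus_point_in_torus by (auto simp: overlap_eq)
  moreover have "open (torus_point -` W)"
    using W(1) continuous_torus_point[of UNIV] by (intro open_vimage)
  ultimately show ?thesis using open_angle_box by auto
qed

lemma transition_has_derivative_id: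
  assumes "x \<in> overlap (angle_chart \<theta>) (angle_chart (\<eta> :: real ^ 'n::finite))"
  shows "(transition (angle_chart \<theta>) (angle_chart \<eta>) has_derivative (\<lambda>v. v)) (at x)"
proof -
  let ?T = "transition (angle_chart \<theta>) (angle_chart \<eta>)"
  obtain d where
    ev: "eventually (\<lambda>y. snd (angle_chart \<eta>) (torus_point y) = y + d) (nhds x)"
    using chart_torus_point_locally_translation[OF transition_angle_chart(2)[OF assms]] by blast
  have "eventually (\<lambda>y. y \<in> overlap (angle_chart \<theta>) (angle_chart \<eta>)) (nhds x)"
    using assms open_overlap by (rule eventually_nhds_in_open[rotated])
  with ev have ev': "eventually (\<lambda>y. y + d = ?T y) (nhds x)"
    by eventually_elim (simp add: transition_angle_chart(1))
  have "((\<lambda>y. y + d) has_derivative (\<lambda>v. v)) (at x)"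
    by (auto intro!: derivative_eq_intros)
  then show ?thesis
    using ev' eventually_nhds_x_imp_x[OF ev']
    by (auto intro: has_derivative_transform_eventually simp: eventually_nhds_conv_at)
qed

lemma jacobian_transition:
  assumes "x \<in> overlap (angle_chart \<theta>) (angle_chart (\<eta> :: real ^ 'n::finite))"
  shows "jacobian (transition (angle_chart \<theta>) (angle_chart \<eta>)) (at x) = mat 1"
proof -
  have "frechet_derivative (transition (angle_chart \<theta>) (angle_chart \<eta>)) (at x) = (\<lambda>v. v)"
    using frechet_derivative_at[OF transition_has_derivative_id[OF assms]] by (rule sym)
  then show ?thesis
    by (simp add: jacobian_def matrix_def mat_def axis_def vec_eq_iff)
qed

section \<open>The smooth structure\<close>

text \<open>Openness of the set is what carries the hypothesis on the values over to the derivatives: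
  the function may be arbitrary elsewhere.\<close>

lemma Ck_on_locally_constant:
  fixes f :: "'a::euclidean_space \<Rightarrow> 'b::real_normed_vector"
  assumes "open S" and "\<And>x. x \<in> S \<Longrightarrow> f x = w"
  shows "Ck_on k S f"
  using assms(2)
proof (induction k arbitrary: f w)
  case 0
  then show ?case
    using continuous_on_cong[of S S f "\<lambda>_. w"] by simp
next
  case (Suc k)
  have D: "(f has_derivative (\<lambda>_. 0)) (at x)" if "x \<in> S" for x
    using has_derivative_transform_within_open[OF has_derivative_const \<open>open S\<close> that] Suc.prems
    by metis
  then have "frechet_derivative f (at x) v = 0" if "x \<in> S" for x v
    using frechet_derivative_at[OF D[OF that]] by metis
  with Suc.IH D show ?case
    by (auto simp: differentiable_def)
qed

text \<open>The first derivatives in a fixed direction are constant, which reduces all higher orders to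
  the constant case.\<close>

lemma smooth_on_derivative_id:
  fixes f :: "'a::euclidean_space \<Rightarrow> 'a"
  assumes "open S" and D: "\<And>x. x \<in> S \<Longrightarrow> (f has_derivative (\<lambda>v. v)) (at x)"
  shows "smooth_on S f"
  unfolding smooth_on_def
proof
  fix k
  have "frechet_derivative f (at x) v = v" if "x \<in> S" for x v
    using frechet_derivative_at[OF D[OF that]] by metis
  moreover have "continuous_on S f"
    using D by (meson continuous_at_imp_continuous_on has_derivative_continuous)
  ultimately show "Ck_on k S f"
    using D \<open>open S\<close> by (cases k) (auto simp: differentiable_def intro: Ck_on_locally_constant)
qed

lemma second_countable_top_of_set: "second_countable_space (top_of_set S)"
  for S :: "'a::second_countable_topology set"
proof -
  obtain B :: "'a set set" where B: "countable B" "\<And>C. C \<in> B \<Longrightarrow> openin (top_of_set S) C"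
    "\<And>T. openin (top_of_set S) T \<Longrightarrow> \<exists>U. U \<subseteq> B \<and> T = \<Union>U"
    using subset_second_countable[of S] by metis
  have "openin (top_of_set S) = arbitrary union_of (\<lambda>W. W \<in> B)"
  proof (intro ext iffI)
    fix T
    show "(arbitrary union_of (\<lambda>W. W \<in> B)) T" if "openin (top_of_set S) T"
      using B(3)[OF that] by (auto simp: union_of_def arbitrary_def)
    show "openin (top_of_set S) T" if "(arbitrary union_of (\<lambda>W. W \<in> B)) T"
      using that B(2) by (auto simp: union_of_def)
  qed
  with B(1) show ?thesis
    unfolding second_countable_space_def by blast
qed

lemma smooth_manifold_torus:
  "smooth_manifold torus_topology (torus_atlas :: (complex ^ 'n::finite, 'n) chart set)"
proof -
  have "(\<Union>c\<in>torus_atlas. fst c) = (torus :: (complex ^ 'n) set)"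
  proof (intro equalityI subsetI)
    fix p :: "complex ^ 'n" assume "p \<in> torus"
    then obtain \<theta> where "p \<in> fst (angle_chart \<theta>)"
      by (rule torus_charted)
    then show "p \<in> (\<Union>c\<in>torus_atlas. fst c)"
      by auto
  qed (use fst_chart_subset in auto)
  moreover have "Hausdorff_space (torus_topology :: (complex ^ 'n) topology)"
    by (simp add: Hausdorff_space_subtopology)
  moreover have "smooth_on (overlap (angle_chart \<theta>) (angle_chart \<eta>))
      (transition (angle_chart \<theta>) (angle_chart \<eta>))" for \<theta> \<eta> :: "real ^ 'n"
    by (rule smooth_on_derivative_id[OF open_overlap]) (rule transition_has_derivative_id)
  ultimately show ?thesis
    unfolding smooth_manifold_def
    by (simp add: second_countable_top_of_set chart_on_angle_chart)
qed

lemma compact_torus: "compact (torus :: (complex ^ 'n::finite) set)"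
proof -
  let ?Q = "cbox (\<chi> i. - pi) (\<chi> i. pi) :: (real ^ 'n) set"
  have "torus = torus_point ` ?Q"
  proof (intro equalityI subsetI)
    fix p :: "complex ^ 'n" assume p: "p \<in> torus"
    have "(\<chi> i. Arg (p $ i)) \<in> ?Q"
      by (simp add: mem_box_cart Arg_le_pi less_imp_le[OF mpi_less_Arg])
    then have "torus_point (\<chi> i. Arg (p $ i)) \<in> torus_point ` ?Q"
      by (rule imageI)
    then show "p \<in> torus_point ` ?Q"
      by (simp only: torus_point_Arg[OF p])
  qed (auto simp: torus_point_in_torus)
  then show ?thesis
    using compact_continuous_image[OF continuous_torus_point compact_cbox] by metis
qed

lemma connected_torus: "connected (torus :: (complex ^ 'n::finite) set)"
  unfolding torus_eq_range
  by (intro connected_continuous_image continuous_torus_point convex_connected convex_UNIV)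

text \<open>Geodesics and integral curves are defined chart by chart. A lift to the angles has the same
  velocity in every chart, so that a single formula serves the whole atlas.\<close>

lemma lifted_curve_chart_derivative:
  assumes \<xi>: "(\<xi> has_vector_derivative v) (at t)"
    and lift: "eventually (\<lambda>s. \<gamma> s = torus_point (\<xi> s)) (nhds t)"
    and dom: "\<gamma> t \<in> fst (angle_chart \<theta>)"
  shows "((snd (angle_chart \<theta>) \<circ> \<gamma>) has_vector_derivative v) (at t)"
proof -
  have "torus_point (\<xi> t) \<in> fst (angle_chart \<theta>)"
    using dom eventually_nhds_x_imp_x[OF lift] by simp
  then obtain d where
    ev: "eventually (\<lambda>y. snd (angle_chart \<theta>) (torus_point y) = y + d) (nhds (\<xi> t))"
    using chart_torus_point_locally_translation by blast
  have "isCont \<xi> t"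
    using \<xi> has_vector_derivative_continuous by blast
  then have "filterlim \<xi> (nhds (\<xi> t)) (nhds t)"
    by (simp add: continuous_at tendsto_nhds_iff)
  then have "eventually (\<lambda>s. snd (angle_chart \<theta>) (torus_point (\<xi> s)) = \<xi> s + d) (nhds t)"
    using ev filterlim_iff by blast
  with lift have *: "eventually (\<lambda>s. \<xi> s + d = (snd (angle_chart \<theta>) \<circ> \<gamma>) s) (nhds t)"
    by eventually_elim simp
  have "((\<lambda>s. \<xi> s + d) has_vector_derivative v) (at t)"
    using \<xi> by (simp add: has_vector_derivative_add_const)
  then show ?thesis
    unfolding has_vector_derivative_def
    using * eventually_nhds_x_imp_x[OF *]
    by (elim has_derivative_transform_eventually) (simp_all add: eventually_nhds_conv_at)
qed

section \<open>A Lorentzian metric with rotating coefficients\<close>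

lemma trig_polynomial_has_derivative:
  fixes A B D :: "'b::real_normed_vector"
  shows "((\<lambda>x :: real ^ 'n::finite. A + cos (x $ i) *\<^sub>R B + sin (x $ i) *\<^sub>R D) has_derivative
      (\<lambda>v. v $ i *\<^sub>R (cos (x $ i) *\<^sub>R D - sin (x $ i) *\<^sub>R B))) (at x)"
  by (auto intro!: derivative_eq_intros bounded_linear.has_derivative[OF bounded_linear_vec_nth]
      simp: algebra_simps)

text \<open>The directional derivatives of such a function are again of the same form, with other
  coefficients; this is why the coefficients vary in the induction on the order.\<close>

lemma Ck_on_trig_polynomial:
  fixes A B D :: "'b::real_normed_vector"
  shows "Ck_on k S (\<lambda>x :: real ^ 'n::finite. A + cos (x $ i) *\<^sub>R B + sin (x $ i) *\<^sub>R D)"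
proof (induction k arbitrary: A B D)
  case 0
  show ?case by (auto intro!: continuous_intros)
next
  case (Suc k)
  have "frechet_derivative (\<lambda>x :: real ^ 'n. A + cos (x $ i) *\<^sub>R B + sin (x $ i) *\<^sub>R D) (at x) v
      = 0 + cos (x $ i) *\<^sub>R (v $ i *\<^sub>R D) + sin (x $ i) *\<^sub>R (- v $ i *\<^sub>R B)" for x v
    unfolding frechet_derivative_at[OF trig_polynomial_has_derivative, symmetric]
    by (simp add: algebra_simps)
  then show ?case
    using differentiableI[OF trig_polynomial_has_derivative] Suc.IH[of 0]
    by (simp only: Ck_on.simps) blast
qed

text \<open>This is \<open>dx\<^sup>2 + dy\<^sup>2 + 2 dz (cos x dx + sin x dy)\<close>. The coefficients depend on \<open>x\<close> only, so that
  the fields of \<open>y\<close>- and \<open>z\<close>-translations are Killing.\<close>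

definition rotating_metric :: "real ^ 3 \<Rightarrow> real ^ 3 ^ 3" where
  "rotating_metric x = vector [vector [1, 0, cos (x $ 1)],
                               vector [0, 1, sin (x $ 1)],
                               vector [cos (x $ 1), sin (x $ 1), 0]]"

text \<open>The form in which smoothness and the derivative of the metric are visible.\<close>

lemma rotating_metric_trig:
  "rotating_metric = (\<lambda>x. vector [vector [1, 0, 0], vector [0, 1, 0], vector [0, 0, 0]]
     + cos (x $ 1) *\<^sub>R vector [vector [0, 0, 1], vector [0, 0, 0], vector [1, 0, 0]]
     + sin (x $ 1) *\<^sub>R vector [vector [0, 0, 0], vector [0, 0, 1], vector [0, 1, 0]])"
  by (simp add: fun_eq_iff rotating_metric_def vec_eq_iff forall_3)

lemma smooth_rotating_metric: "smooth_on S rotating_metric"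
  unfolding smooth_on_def rotating_metric_trig by (blast intro: Ck_on_trig_polynomial)

lemma partial_deriv_rotating_metric:
  "partial_deriv i rotating_metric x =
     (if i = 1 then vector [vector [0, 0, - sin (x $ 1)],
                            vector [0, 0, cos (x $ 1)],
                            vector [- sin (x $ 1), cos (x $ 1), 0]]
      else 0)"
  unfolding partial_deriv_def rotating_metric_trig
    frechet_derivative_at[OF trig_polynomial_has_derivative, symmetric]
  by (simp add: axis_def vec_eq_iff forall_3)

lemma matrix_inv_eqI:
  fixes A B :: "real ^ 'n::finite ^ 'n"
  assumes "A ** B = mat 1" "B ** A = mat 1"
  shows "matrix_inv A = B"
proof -
  have "A ** matrix_inv A = mat 1 \<and> matrix_inv A ** A = mat 1"
    unfolding matrix_inv_def by (rule someI[of _ B]) (simp add: assms)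
  then show ?thesis
    using assms by (metis matrix_mul_assoc matrix_mul_lid matrix_mul_rid)
qed

lemma matrix_inv_rotating_metric:
  "matrix_inv (rotating_metric x) =
     vector [vector [(sin (x $ 1))\<^sup>2, - (cos (x $ 1) * sin (x $ 1)), cos (x $ 1)],
             vector [- (cos (x $ 1) * sin (x $ 1)), (cos (x $ 1))\<^sup>2, sin (x $ 1)],
             vector [cos (x $ 1), sin (x $ 1), - 1]]"
proof -
  have "(sin (x $ 1))\<^sup>2 = 1 - (cos (x $ 1))\<^sup>2"
    by (simp add: sin_squared_eq)
  then show ?thesis
    by (intro matrix_inv_eqI; simp add: rotating_metric_def matrix_matrix_mult_def mat_def vec_eq_iff
        forall_3 sum_3 power2_eq_square algebra_simps)
qed

lemma lorentzian_rotating_metric: "lorentzian_matrix (rotating_metric x)"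
  unfolding lorentzian_matrix_def
proof (intro exI conjI)
  let ?C = "cos (x $ 1)" and ?S = "sin (x $ 1)"
  \<comment> \<open>With \<open>e = (cos x, sin x, 0)\<close>, the columns are \<open>e\<close>, its rotation by a quarter turn,
    and \<open>e - \<partial>\<^sub>z\<close>, which is timelike because \<open>g(e, e) = g(e, \<partial>\<^sub>z) = 1\<close> and \<open>\<partial>\<^sub>z\<close> is null.\<close>
  let ?P = "vector [vector [?C, - ?S, ?C], vector [?S, ?C, ?S], vector [0, 0, -1]] :: real ^ 3 ^ 3"
  have *: "?S * ?S = 1 - ?C * ?C"
    by (simp add: sin_squared_eq flip: power2_eq_square)
  then have "det ?P = -1"
    by (simp add: det_3)
  then show "invertible ?P"
    by (simp add: invertible_det_nz)
  show "transpose ?P ** rotating_metric x ** ?P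
      = (\<chi> i j. if i \<noteq> j then 0 else if i = 3 then - 1 else 1)"
    using * by (simp add: rotating_metric_def matrix_matrix_mult_def transpose_def vec_eq_iff
        forall_3 sum_3 algebra_simps)
qed

lemma rotating_metric_periodic:
  "torus_point x = torus_point y \<Longrightarrow> rotating_metric x = rotating_metric y"
  by (auto simp: torus_point_def rotating_metric_def vec_eq_iff cis.ctr complex_eq_iff)


text \<open>The geodesic equation is \<open>u' = G\<inverse> F\<close>. Here \<open>F\<close> collects the terms quadratic in the velocity of the
  Euler-Lagrange equations of \<open>(x'\<^sup>2 + y'\<^sup>2) / 2 + z' (x' cos x + y' sin x)\<close>, and the coefficients
  of the \<open>F\<close>s below are the rows of the inverse of the metric.\<close>

lemma christoffel_rotating_metric:
  fixes x u :: "real ^ 3"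
  defines "\<Gamma> k \<equiv> \<Sum>i\<in>UNIV. \<Sum>j\<in>UNIV. christoffel rotating_metric k i j x * u $ i * u $ j"
  defines "C \<equiv> cos (x $ 1)" and "S \<equiv> sin (x $ 1)"
  defines "F1 \<equiv> C * u $ 2 * u $ 3" and "F2 \<equiv> - C * u $ 1 * u $ 3"
    and "F3 \<equiv> S * (u $ 1)\<^sup>2 - C * u $ 1 * u $ 2"
  shows "\<Gamma> 1 = - (S\<^sup>2 * F1 - C * S * F2 + C * F3)"
    and "\<Gamma> 2 = - (- C * S * F1 + C\<^sup>2 * F2 + S * F3)"
    and "\<Gamma> 3 = - (C * F1 + S * F2 - F3)"
  unfolding F1_def F2_def F3_def \<Gamma>_def christoffel_def matrix_inv_rotating_metric
    partial_deriv_rotating_metric C_def[symmetric] S_def[symmetric]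
  by (simp_all add: sum_3) (simp_all add: field_simps power2_eq_square)

lemma lorentzian_metric_torus: "lorentzian_metric torus_atlas (\<lambda>_. rotating_metric)"
proof -
  have "rotating_metric x = transpose (jacobian (transition (angle_chart \<theta>) (angle_chart \<eta>)) (at x))
      ** rotating_metric (transition (angle_chart \<theta>) (angle_chart \<eta>) x)
      ** jacobian (transition (angle_chart \<theta>) (angle_chart \<eta>)) (at x)"
    if x: "x \<in> overlap (angle_chart \<theta>) (angle_chart \<eta>)" for x \<theta> \<eta>
  proof -
    have "torus_point (transition (angle_chart \<theta>) (angle_chart \<eta>) x) = torus_point x"
      using transition_angle_chart[OF x] torus_point_chart by metis
    from rotating_metric_periodic[OF this] show ?thesis
      by (simp add: jacobian_transition[OF x])
  qed
  then show ?thesis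
    unfolding lorentzian_metric_def smooth_bilinear_field_def
    by (auto simp: smooth_rotating_metric lorentzian_rotating_metric)
qed

section \<open>An incomplete geodesic\<close>

lemma has_vector_derivative_vector_3:
  assumes "(f has_real_derivative f') (at t)" "(g has_real_derivative g') (at t)"
    "(h has_real_derivative h') (at t)"
  shows "((\<lambda>t. vector [f t, g t, h t] :: real ^ 3) has_vector_derivative vector [f', g', h']) (at t)"
proof -
  have *: "vector [a, b, c] = a *\<^sub>R axis 1 1 + b *\<^sub>R axis 2 1 + c *\<^sub>R (axis 3 1 :: real ^ 3)" for a b c
    by (simp add: vec_eq_iff forall_3 axis_def)
  show ?thesis
    unfolding * using assms by (auto intro!: derivative_eq_intros)
qed

text \<open>The geodesic with \<open>g(\<partial>\<^sub>z, u) = -1\<close>, \<open>g(\<partial>\<^sub>y, u) = 0\<close> and \<open>g(u, u) = -1\<close>. Put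
  \<open>w = - x' sin x + y' cos x\<close>. The first condition says \<open>x' cos x + y' sin x = -1\<close>, the third one
  then gives \<open>z' = 1 + w\<^sup>2 / 2\<close>, and the second one becomes
  \<open>0 = y' + z' sin x = w cos x + (w\<^sup>2 / 2) sin x\<close>.
  The nonzero root is \<open>w = - 2 cot x\<close>, which leads to \<open>x' = cos x\<close>, \<open>y' = sin x - 2 / sin x\<close> and
  \<open>z' = 2 / sin\<^sup>2 x - 1\<close>. The solution of the first of these with \<open>x(0) = 0\<close> satisfies
  \<open>sin x = tanh t\<close> and \<open>cos x = 1 / cosh t\<close>; integrating the others gives the formula below.\<close>

definition escaping_angles :: "real \<Rightarrow> real ^ 3" where
  "escaping_angles t = vector [arctan (sinh t), ln (cosh t) - 2 * ln (sinh t), t - 2 / tanh t]"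

definition escaping_velocity :: "real \<Rightarrow> real ^ 3" where
  "escaping_velocity t = vector [1 / cosh t, tanh t - 2 / tanh t, 2 / (tanh t)\<^sup>2 - 1]"

definition escaping_acceleration :: "real \<Rightarrow> real ^ 3" where
  "escaping_acceleration t = vector [- tanh t / cosh t,
     (1 - (tanh t)\<^sup>2) * (1 + 2 / (tanh t)\<^sup>2), - 4 * (1 - (tanh t)\<^sup>2) / tanh t ^ 3]"

lemma escaping_angles_derivative:
  assumes "t > 0"
  shows "(escaping_angles has_vector_derivative escaping_velocity t) (at t)"
proof -
  have pos: "sinh t > 0" "cosh t > 0" "tanh t > 0"
    using assms by (simp_all add: cosh_real_pos)
  have "((\<lambda>t. arctan (sinh t)) has_real_derivative cosh t / (1 + (sinh t)\<^sup>2)) (at t)"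
    by (auto intro!: derivative_eq_intros simp: inverse_eq_divide)
  also have "cosh t / (1 + (sinh t)\<^sup>2) = 1 / cosh t"
    using pos by (simp add: cosh_square_eq[of t, symmetric] add.commute[of 1])
      (simp add: power2_eq_square)
  finally have "((\<lambda>t. arctan (sinh t)) has_real_derivative 1 / cosh t) (at t)" .
  moreover have "((\<lambda>t. ln (cosh t) - 2 * ln (sinh t)) has_real_derivative tanh t - 2 / tanh t) (at t)"
    using pos by (auto intro!: derivative_eq_intros simp: tanh_def)
  moreover have "((\<lambda>t. t - 2 / tanh t) has_real_derivative 2 / (tanh t)\<^sup>2 - 1) (at t)"
    using pos by (auto intro!: derivative_eq_intros simp: power2_eq_square field_simps)
  ultimately show ?thesis
    unfolding escaping_angles_def escaping_velocity_def by (rule has_vector_derivative_vector_3)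
qed

lemma escaping_velocity_derivative:
  assumes "t > 0"
  shows "(escaping_velocity has_vector_derivative escaping_acceleration t) (at t)"
proof -
  have pos: "sinh t > 0" "cosh t > 0" "tanh t > 0"
    using assms by (simp_all add: cosh_real_pos)
  have "((\<lambda>t. 1 / cosh t) has_real_derivative - tanh t / cosh t) (at t)"
    using pos by (auto intro!: derivative_eq_intros simp: tanh_def)
  moreover have "((\<lambda>t. tanh t - 2 / tanh t) has_real_derivative
      (1 - (tanh t)\<^sup>2) * (1 + 2 / (tanh t)\<^sup>2)) (at t)"
    using pos by (auto intro!: derivative_eq_intros simp: power2_eq_square field_simps)
  moreover have "((\<lambda>t. 2 / (tanh t)\<^sup>2 - 1) has_real_derivative
      - 4 * (1 - (tanh t)\<^sup>2) / tanh t ^ 3) (at t)"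
    using pos by (auto intro!: derivative_eq_intros simp: power2_eq_square power3_eq_cube field_simps)
  ultimately show ?thesis
    unfolding escaping_velocity_def escaping_acceleration_def by (rule has_vector_derivative_vector_3)
qed

text \<open>The position enters only through the point of the torus, so the equation holds at once in
  all charts.\<close>

lemma escaping_geodesic_equation:
  assumes t: "t > 0" and x: "torus_point x = torus_point (escaping_angles t)"
  shows "escaping_acceleration t $ k + (\<Sum>i\<in>UNIV. \<Sum>j\<in>UNIV.
      christoffel rotating_metric k i j x * escaping_velocity t $ i * escaping_velocity t $ j) = 0"
proof -
  \<comment> \<open>In these variables the equation is a polynomial consequence of the two relations below.\<close>
  define S C w where "S = tanh t" and "C = 1 / cosh t" and "w = 1 / tanh t"
  have "cis (x $ 1) = cis (arctan (sinh t))"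
    using x by (simp add: torus_point_def vec_eq_iff forall_3 escaping_angles_def)
  then have "cos (x $ 1) = cos (arctan (sinh t))" "sin (x $ 1) = sin (arctan (sinh t))"
    by (simp_all add: complex_eq_iff)
  moreover have "sqrt (1 + (sinh t)\<^sup>2) = cosh t"
    by (rule real_sqrt_unique) (simp_all add: cosh_square_eq)
  ultimately have CS: "cos (x $ 1) = C" "sin (x $ 1) = S"
    by (simp_all add: cos_arctan sin_arctan C_def S_def tanh_def)
  have rel: "C\<^sup>2 = 1 - S\<^sup>2" "S * w = 1"
    using CS t by (auto simp: S_def w_def cos_squared_eq simp flip: CS)
  have v: "escaping_velocity t = vector [C, S - 2 * w, 2 * w\<^sup>2 - 1]"
    by (simp add: escaping_velocity_def C_def S_def w_def power_divide)
  have a: "escaping_acceleration t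
      = vector [- S * C, (1 - S\<^sup>2) * (1 + 2 * w\<^sup>2), - 4 * (1 - S\<^sup>2) * w ^ 3]"
    by (simp add: escaping_acceleration_def C_def S_def w_def power_divide)
  have "\<forall>k. escaping_acceleration t $ k + (\<Sum>i\<in>UNIV. \<Sum>j\<in>UNIV.
      christoffel rotating_metric k i j x * escaping_velocity t $ i * escaping_velocity t $ j) = 0"
    unfolding forall_3 christoffel_rotating_metric CS v a vector_3
    using rel by (intro conjI; algebra)
  then show ?thesis ..
qed

lemma escaping_curve_geodesic:
  "geodesic_on torus_topology torus_atlas (\<lambda>_. rotating_metric) {0<..}
     (\<lambda>t. torus_point (escaping_angles t))"
  unfolding geodesic_on_def
proof (intro conjI ballI)
  have "continuous_on {0<..} escaping_angles"
    using escaping_angles_derivative has_vector_derivative_continuous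
    by (intro continuous_at_imp_continuous_on) blast
  then have "continuous_on {0<..} (\<lambda>t. torus_point (escaping_angles t))"
    by (rule continuous_on_compose2[OF continuous_torus_point[of UNIV]]) simp
  then show "continuous_map (top_of_set {0<..}) torus_topology (\<lambda>t. torus_point (escaping_angles t))"
    by (simp add: continuous_map_in_subtopology torus_point_in_torus image_subset_iff)
  fix c :: "(complex ^ 3, 3) chart" assume "c \<in> torus_atlas"
  then obtain \<theta> where c: "c = angle_chart \<theta>" by blast
  show "\<exists>u a. \<forall>t\<in>{0<..}. torus_point (escaping_angles t) \<in> fst c \<longrightarrow>
        ((snd c \<circ> (\<lambda>t. torus_point (escaping_angles t))) has_vector_derivative u t) (at t) \<and>
        (u has_vector_derivative a t) (at t) \<and>
        (\<forall>k. a t $ k + (\<Sum>i\<in>UNIV. \<Sum>j\<in>UNIV.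
           christoffel rotating_metric k i j (snd c (torus_point (escaping_angles t))) * u t $ i * u t $ j) = 0)"
  proof (intro exI ballI impI conjI allI)
    fix t :: real and k assume t: "t \<in> {0<..}" and dom: "torus_point (escaping_angles t) \<in> fst c"
    show "((snd c \<circ> (\<lambda>t. torus_point (escaping_angles t))) has_vector_derivative escaping_velocity t) (at t)"
      unfolding c
      by (rule lifted_curve_chart_derivative[OF escaping_angles_derivative])
        (use t dom c in auto)
    show "(escaping_velocity has_vector_derivative escaping_acceleration t) (at t)"
      using t by (simp add: escaping_velocity_derivative)
    show "escaping_acceleration t $ k + (\<Sum>i\<in>UNIV. \<Sum>j\<in>UNIV.
        christoffel rotating_metric k i j (snd c (torus_point (escaping_angles t)))
          * escaping_velocity t $ i * escaping_velocity t $ j) = 0"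
      using t dom torus_point_chart unfolding c by (intro escaping_geodesic_equation) auto
  qed
qed auto

lemma geodesic_on_velocity:
  assumes "geodesic_on X A g I \<gamma>" "c \<in> A"
  obtains u a where
    "\<And>t. t \<in> I \<Longrightarrow> \<gamma> t \<in> fst c \<Longrightarrow> ((snd c \<circ> \<gamma>) has_vector_derivative u t) (at t)"
    "\<And>t. t \<in> I \<Longrightarrow> \<gamma> t \<in> fst c \<Longrightarrow> (u has_vector_derivative a t) (at t)"
  using assms unfolding geodesic_on_def by (elim conjE) (drule (1) bspec, blast)

text \<open>The projection to the torus of the curve \<open>escaping_angles\<close> winds around infinitely often as
  \<open>t\<close> decreases to \<open>0\<close>, so its behaviour there cannot be read off in one chart. A hypothetical
  extension, however, is continuous at \<open>0\<close>, hence stays in a chart around its position there and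
  has a continuous velocity in it. This contradicts \<open>z' = 2 / tanh\<^sup>2 t - 1\<close>.\<close>

lemma geodesically_incomplete_torus:
  "geodesically_incomplete torus_topology torus_atlas (\<lambda>_. rotating_metric)"
  unfolding geodesically_incomplete_def
proof (intro exI conjI notI)
  show "geodesic_on torus_topology torus_atlas (\<lambda>_. rotating_metric) {0<..}
     (\<lambda>t. torus_point (escaping_angles t))"
    by (rule escaping_curve_geodesic)
  assume "\<exists>\<delta>. geodesic_on torus_topology torus_atlas (\<lambda>_. rotating_metric) UNIV \<delta> \<and>
    (\<forall>t\<in>{0<..}. \<delta> t = torus_point (escaping_angles t))"
  then obtain \<delta> where geo: "geodesic_on torus_topology torus_atlas (\<lambda>_. rotating_metric) UNIV \<delta>"
    and ext: "\<And>t. t > 0 \<Longrightarrow> \<delta> t = torus_point (escaping_angles t)"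
    by auto
  have cont: "continuous_map euclideanreal torus_topology \<delta>"
    using geo by (simp add: geodesic_on_def)
  have "\<delta> 0 \<in> torus"
    using continuous_map_funspace[OF cont] by (auto simp: Pi_iff)
  then obtain \<theta> where \<theta>: "\<delta> 0 \<in> fst (angle_chart \<theta>)"
    by (rule torus_charted)
  obtain u a where u: "\<And>t. \<delta> t \<in> fst (angle_chart \<theta>) \<Longrightarrow>
      ((snd (angle_chart \<theta>) \<circ> \<delta>) has_vector_derivative u t) (at t)"
    and a: "\<And>t. \<delta> t \<in> fst (angle_chart \<theta>) \<Longrightarrow> (u has_vector_derivative a t) (at t)"
    using geodesic_on_velocity[OF geo, of "angle_chart \<theta>"] by auto
  have "isCont u 0"
    by (rule has_vector_derivative_continuous[OF a[OF \<theta>]])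
  then have "(u \<longlongrightarrow> u 0) (at_right 0)"
    by (simp add: continuous_at filterlim_at_split)
  then have "((\<lambda>t. u t $ 3 * (tanh t)\<^sup>2) \<longlongrightarrow> u 0 $ 3 * (tanh 0)\<^sup>2) (at_right 0)"
    by (intro tendsto_intros) auto
  \<comment> \<open>Multiplying by \<open>tanh\<^sup>2 t\<close> turns the blow-up into two different finite limits, \<open>0\<close> and \<open>2\<close>.\<close>
  moreover have "eventually (\<lambda>t. u t $ 3 * (tanh t)\<^sup>2 = 2 - (tanh t)\<^sup>2) (at_right 0)"
  proof -
    have "open (\<delta> -` fst (angle_chart \<theta>))"
      using openin_continuous_map_preimage[OF cont openin_chart_domain[of \<theta>]] by (simp add: vimage_def)
    then have "eventually (\<lambda>t. \<delta> t \<in> fst (angle_chart \<theta>)) (at_right 0)"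
      using \<theta> eventually_at_filter eventually_nhds_in_open[of "\<delta> -` fst (angle_chart \<theta>)" 0]
      by (auto elim: eventually_mono simp: eventually_at_filter)
    moreover have "eventually (\<lambda>t::real. t > 0) (at_right 0)"
      by (rule eventually_at_right_less)
    ultimately show ?thesis
    proof eventually_elim
      case (elim t)
      have "((snd (angle_chart \<theta>) \<circ> \<delta>) has_vector_derivative escaping_velocity t) (at t)"
      proof (rule lifted_curve_chart_derivative[OF escaping_angles_derivative[OF elim(2)]])
        show "eventually (\<lambda>s. \<delta> s = torus_point (escaping_angles s)) (nhds t)"
          using eventually_nhds_in_open[of "{0<..}" t] elim(2) ext
          by (auto elim: eventually_mono)
      qed (rule elim(1))
      then have "u t = escaping_velocity t"
        by (rule vector_derivative_unique_at[OF u[OF elim(1)]])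
      then show ?case
        using elim(2) by (simp add: escaping_velocity_def field_simps)
    qed
  qed
  ultimately have "((\<lambda>t. 2 - (tanh t)\<^sup>2) \<longlongrightarrow> 0) (at_right (0::real))"
    by (simp add: tendsto_cong)
  moreover have "((\<lambda>t. 2 - (tanh t)\<^sup>2) \<longlongrightarrow> 2 - (tanh 0)\<^sup>2) (at_right (0::real))"
    by (intro tendsto_intros) auto
  ultimately show False
    using tendsto_unique[OF trivial_limit_at_right_real] by fastforce
qed

section \<open>The periodic null Killing field\<close>

abbreviation last_coordinate_field :: "(complex ^ 3, 3) vector_field" where
  "last_coordinate_field \<equiv> \<lambda>_ _. axis 3 1"

text \<open>For \<open>z\<close> on the unit circle this is the circle action; with \<open>z = cis t\<close> it is the flow of
  \<open>\<partial>\<^sub>z\<close>, which therefore has period \<open>2 \<pi>\<close>.\<close>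

definition turn_last :: "complex \<Rightarrow> complex ^ 3 \<Rightarrow> complex ^ 3" where
  "turn_last z p = (\<chi> i. if i = 3 then z * p $ 3 else p $ i)"

lemma turn_last_torus: "cmod z = 1 \<Longrightarrow> p \<in> torus \<Longrightarrow> turn_last z p \<in> torus"
  by (simp add: torus_def turn_last_def norm_mult)

lemma turn_last_torus_point:
  "turn_last (cis t) (torus_point x) = torus_point (x + t *\<^sub>R axis 3 1)"
  by (simp add: turn_last_def torus_point_def vec_eq_iff axis_def cis_mult add.commute)

lemma flow_turn_last:
  "flow_of torus_topology torus_atlas last_coordinate_field (\<lambda>t. turn_last (cis t))"
  unfolding flow_of_def
proof (intro ballI conjI)
  fix p :: "complex ^ 3" assume "p \<in> topspace torus_topology"
  then obtain x where p: "p = torus_point x"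
    by (auto simp: torus_eq_range)
  show "turn_last (cis 0) p = p"
    by (simp add: turn_last_def vec_eq_iff)
  have line: "(\<lambda>t. turn_last (cis t) p) = (\<lambda>t. torus_point (x + t *\<^sub>R axis 3 1))"
    by (simp add: p turn_last_torus_point)
  have "continuous_on UNIV (\<lambda>t. torus_point (x + t *\<^sub>R axis 3 1))"
    by (rule continuous_on_compose2[OF continuous_torus_point[of UNIV]]) (auto intro!: continuous_intros)
  then have "continuous_map euclideanreal torus_topology (\<lambda>t. torus_point (x + t *\<^sub>R axis 3 1))"
    by (simp add: continuous_map_in_subtopology torus_point_in_torus image_subset_iff)
  moreover have "((\<lambda>t. x + t *\<^sub>R axis 3 1) has_vector_derivative axis 3 1) (at t)" for t
    by (auto intro!: derivative_eq_intros)
  ultimately show "integral_curve torus_topology torus_atlas last_coordinate_field (\<lambda>t. turn_last (cis t) p)"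
    unfolding integral_curve_def line
    by (auto intro!: lifted_curve_chart_derivative[where \<xi> = "\<lambda>t. x + t *\<^sub>R axis 3 1"])
qed

lemma circle_action_turn_last: "circle_action torus_topology turn_last"
  unfolding circle_action_def
proof (intro conjI ballI)
  have "continuous_on (sphere 0 1 \<times> torus) (\<lambda>(z, p). turn_last z p)"
    unfolding turn_last_def case_prod_unfold
  proof (intro continuous_on_vec_lambda)
    fix i :: 3
    show "continuous_on (sphere 0 1 \<times> torus)
        (\<lambda>q :: complex \<times> (complex ^ 3). if i = 3 then fst q * snd q $ 3 else snd q $ i)"
      by (cases "i = 3") (auto intro!: continuous_intros)
  qed
  then show "continuous_map (prod_topology (top_of_set (sphere 0 1)) torus_topology) torus_topology
      (\<lambda>(z, p). turn_last z p)"
    by (auto simp: prod_topology_subtopology_eu continuous_map_in_subtopology turn_last_torus)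
qed (simp_all add: turn_last_def vec_eq_iff)

lemma periodic_field_torus: "periodic_field torus_topology torus_atlas last_coordinate_field"
  unfolding periodic_field_def
  using flow_turn_last circle_action_turn_last
  by (intro exI[of _ "\<lambda>t. turn_last (cis t)"] exI[of _ turn_last] exI[of _ "2 * pi"]) simp

lemma null_killing_field_torus:
  "null_killing_field torus_atlas (\<lambda>_. rotating_metric) last_coordinate_field"
proof -
  have "smooth_on (angle_box \<theta>) (\<lambda>_. axis 3 1 :: real ^ 3)" for \<theta> :: "real ^ 3"
    by (auto simp: smooth_on_def intro: Ck_on_locally_constant open_angle_box)
  moreover have "axis 3 1 \<noteq> (0 :: real ^ 3)"
    by (simp add: axis_eq_0_iff)
  moreover have "axis 3 1 \<bullet> (rotating_metric x *v axis 3 1) = 0" for x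
    unfolding inner_axis' by (simp add: rotating_metric_def matrix_vector_mult_def sum_3 axis_def)
  moreover have "partial_deriv i (\<lambda>_. axis 3 1 :: real ^ 3) x = 0" for i :: 3 and x
    by (simp add: partial_deriv_def)
  ultimately show ?thesis
    unfolding null_killing_field_def killing_field_def smooth_vector_field_def
    by (simp add: chart_image_angle_chart jacobian_transition sum_3 partial_deriv_rotating_metric)
      (simp add: axis_def)
qed

section \<open>The example\<close>

theorem theorem1p7:
  shows "\<exists>(X :: (complex ^ 3) topology) (A :: (complex ^ 3, 3) chart set) g V.
    lorentzian_manifold X A g \<and> compact_space X \<and>
    geodesically_incomplete X A g \<and>
    null_killing_field A g V \<and> periodic_field X A V"
proof (intro exI conjI)
  show "lorentzian_manifold torus_topology torus_atlas (\<lambda>_. rotating_metric)"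
    unfolding lorentzian_manifold_def
    by (simp add: smooth_manifold_torus connected_torus lorentzian_metric_torus connected_space_subtopology)
  show "compact_space (torus_topology :: (complex ^ 3) topology)"
    by (simp add: compact_torus compact_space_subtopology)
qed (rule geodesically_incomplete_torus null_killing_field_torus periodic_field_torus)+

end
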